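(* For all $\varepsilon>0$ there exist $f$ and $\mathcal{D}$ such that for all $\delta>0$: (i) using the standard protocol, Alice and Bob need to exchange $\Omega\!\left(\frac{1}{\varepsilon^2\log\frac{2}{(1-\delta)\varepsilon}}\right)$ messages before they $(\varepsilon,\delta)$-agree; (ii) using a different protocol, they need only exchange $2$ messages, both consisting of $O(\log 1/\delta)$ bits, to $(\varepsilon,\delta)$-agree. In particular, if $\delta=1/2$, then the standard protocol needs $\Omega\!\left(\frac{1/\varepsilon^2}{\log 1/\varepsilon}\right)$ bits whereas the protocol of (ii) needs $O(1)$ bits.
   Context: Setting: a finite state space $\Omega$ consisting of pairs $\omega=(x,y)$, where Alice knows $x$ and Bob knows $y$; a common prior $\mathcal{D}$ on $\Omega$; and $f:\Omega\to[0,1]$. After $t$ messages, $\Omega_{i,t}(\omega)$ is the set of states agent $i$ considers possible, and $E_{i,t}(\omega)=\mathbb{E}_{\mathcal{D}}[f\mid\Omega_{i,t}(\omega)]$. A general (deterministic) protocol alternates messages, each being a function of the sender's current knowledge set; the receiver intersects its set with the set of states at which the sender would have sent the same message. The standard protocol is the protocol in which the sender announces its exact current expectation $E_{i,t}(\omega)$, a real number. The agents $(\varepsilon,\delta)$-agree after the $t$-th message if $\Pr_{\omega\sim\mathcal{D}}[|E_{A,t}-E_{B,t}|>\varepsilon]\le\delta$. *)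

theory Defs
  imports "HOL-Probability.Probability" "HOL-Library.Sublist"
begin

datatype agent = Alice | Bob

text \<open>
  A state is a pair \<open>(x, y)\<close>: Alice knows \<open>x\<close> and Bob knows \<open>y\<close>. Messages are numbered from \<open>0\<close>,
  so message number \<open>t\<close> is the one that is sent after \<open>t\<close> messages have been exchanged.
  A protocol maps \<open>t\<close> and the knowledge set of the sender to message number \<open>t\<close>.
\<close>

type_synonym ('a, 'b, 'm) protocol = "nat \<Rightarrow> ('a \<times> 'b) set \<Rightarrow> 'm"

definition sender :: "nat \<Rightarrow> agent" where
  "sender t = (if even t then Alice else Bob)"

fun same_input :: "agent \<Rightarrow> 'a \<times> 'b \<Rightarrow> 'a \<times> 'b \<Rightarrow> bool" where
  "same_input Alice \<omega> \<omega>' \<longleftrightarrow> fst \<omega> = fst \<omega>'"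
| "same_input Bob \<omega> \<omega>' \<longleftrightarrow> snd \<omega> = snd \<omega>'"

primrec knowledge ::
  "('a \<times> 'b) set \<Rightarrow> ('a, 'b, 'm) protocol \<Rightarrow> nat \<Rightarrow> agent \<Rightarrow> 'a \<times> 'b \<Rightarrow> ('a \<times> 'b) set" where
  "knowledge \<Omega> P 0 i \<omega> = {\<omega>' \<in> \<Omega>. same_input i \<omega> \<omega>'}"
| "knowledge \<Omega> P (Suc t) i \<omega> =
    (if i = sender t then knowledge \<Omega> P t i \<omega>
     else knowledge \<Omega> P t i \<omega> \<inter>
       {\<omega>' \<in> \<Omega>. P t (knowledge \<Omega> P t (sender t) \<omega>') = P t (knowledge \<Omega> P t (sender t) \<omega>)})"

definition message ::
  "('a \<times> 'b) set \<Rightarrow> ('a, 'b, 'm) protocol \<Rightarrow> nat \<Rightarrow> 'a \<times> 'b \<Rightarrow> 'm" where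
  "message \<Omega> P t \<omega> = P t (knowledge \<Omega> P t (sender t) \<omega>)"

definition cond_expectation ::
  "('a \<times> 'b) pmf \<Rightarrow> ('a \<times> 'b \<Rightarrow> real) \<Rightarrow> ('a \<times> 'b) set \<Rightarrow> real" where
  "cond_expectation D f K = measure_pmf.expectation (cond_pmf D K) f"

definition standard_protocol ::
  "('a \<times> 'b) pmf \<Rightarrow> ('a \<times> 'b \<Rightarrow> real) \<Rightarrow> ('a, 'b, real) protocol" where
  "standard_protocol D f t K = cond_expectation D f K"

definition agent_expectation ::
  "('a \<times> 'b) set \<Rightarrow> ('a \<times> 'b) pmf \<Rightarrow> ('a \<times> 'b \<Rightarrow> real) \<Rightarrow> ('a, 'b, 'm) protocol \<Rightarrow>
    agent \<Rightarrow> nat \<Rightarrow> 'a \<times> 'b \<Rightarrow> real" where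
  "agent_expectation \<Omega> D f P i t \<omega> = cond_expectation D f (knowledge \<Omega> P t i \<omega>)"

definition agree_after ::
  "('a \<times> 'b) set \<Rightarrow> ('a \<times> 'b) pmf \<Rightarrow> ('a \<times> 'b \<Rightarrow> real) \<Rightarrow> ('a, 'b, 'm) protocol \<Rightarrow>
    real \<Rightarrow> real \<Rightarrow> nat \<Rightarrow> bool" where
  "agree_after \<Omega> D f P \<epsilon> \<delta> t \<longleftrightarrow>
    measure_pmf.prob D
      {\<omega>. \<bar>agent_expectation \<Omega> D f P Alice t \<omega> - agent_expectation \<Omega> D f P Bob t \<omega>\<bar> > \<epsilon>} \<le> \<delta>"

text \<open>
  Real-valued messages have no length of their own. Their cost in bits is measured through a
  binary code for the possible messages at each point in time; the code has to be prefix-free,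
  so that the receiver can tell where a message ends.
\<close>

definition prefix_free_on :: "'m set \<Rightarrow> ('m \<Rightarrow> bool list) \<Rightarrow> bool" where
  "prefix_free_on M enc \<longleftrightarrow> (\<forall>u\<in>M. \<forall>v\<in>M. u \<noteq> v \<longrightarrow> \<not> prefix (enc u) (enc v))"

definition valid_encoding ::
  "('a \<times> 'b) set \<Rightarrow> ('a, 'b, 'm) protocol \<Rightarrow> (nat \<Rightarrow> 'm \<Rightarrow> bool list) \<Rightarrow> bool" where
  "valid_encoding \<Omega> P enc \<longleftrightarrow> (\<forall>t. prefix_free_on (message \<Omega> P t ` \<Omega>) (enc t))"

definition bits_sent ::
  "('a \<times> 'b) set \<Rightarrow> ('a, 'b, 'm) protocol \<Rightarrow> (nat \<Rightarrow> 'm \<Rightarrow> bool list) \<Rightarrow> nat \<Rightarrow> 'a \<times> 'b \<Rightarrow> nat" where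
  "bits_sent \<Omega> P enc t \<omega> = (\<Sum>k<t. length (enc k (message \<Omega> P k \<omega>)))"

end

theory Submission
  imports Defs
begin

text \<open>
  Alice holds random bits \<open>w\<^sub>0, w\<^sub>2, \<dots>\<close> and Bob \<open>w\<^sub>1, w\<^sub>3, \<dots>\<close>, with values \<open>\<plusminus>1\<close>; put
  \<open>z\<^sub>0 = w\<^sub>0\<close>, \<open>z\<^sub>t = w\<^sub>t\<^sub>-\<^sub>1 w\<^sub>t\<close> and \<open>S\<^sub>k = z\<^sub>0 + \<dots> + z\<^sub>k\<^sub>-\<^sub>1\<close>. Each agent also holds one more bit,
  uniformly distributed by itself, and \<open>f\<close> is the exclusive or of these two bits. Given \<open>f\<close>, the
  \<open>z\<^sub>t\<close> are independent tosses of a coin whose bias is about \<open>\<theta>\<close>, of order \<open>\<epsilon>\<close>, towards \<open>+1\<close>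
  if \<open>f = 1\<close> and towards \<open>-1\<close> if \<open>f = 0\<close>.

  Exchanging the two extra bits settles \<open>f\<close>. In the standard protocol, however, an agent who
  knows \<open>w\<^sub>0, \<dots>, w\<^sub>k\<^sub>-\<^sub>1\<close> and the rest of its own input learns nothing about \<open>f\<close> beyond
  \<open>z\<^sub>0, \<dots>, z\<^sub>k\<^sub>-\<^sub>1\<close>: flipping \<open>f\<close> together with all unknown bits of the other agent negates every
  later \<open>z\<^sub>t\<close> and thus preserves the likelihood of these. Its expectation is therefore the logistic
  function of \<open>2 \<theta> S\<^sub>k\<close>, and message \<open>t\<close> reveals \<open>z\<^sub>t\<close> and nothing else. Since the agents are always
  exactly one toss apart, they disagree by more than \<open>\<epsilon>\<close> as long as \<open>|S\<^sub>t|\<close> is at most of order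
  \<open>1/\<epsilon>\<close>; a Chernoff bound shows that this fails with probability at most
  \<open>2 exp (- c / (\<epsilon>\<^sup>2 t))\<close>.
\<close>

section \<open>Knowledge sets\<close>

lemma knowledge_same_input:
  "\<omega>' \<in> knowledge \<Omega> P t i \<omega> \<Longrightarrow> \<omega>' \<in> \<Omega> \<and> same_input i \<omega> \<omega>'"
  by (induction t) (auto split: if_splits)

lemma knowledge_refl: "\<omega> \<in> \<Omega> \<Longrightarrow> \<omega> \<in> knowledge \<Omega> P t i \<omega>"
proof (induction t)
  case 0
  then show ?case by (cases i) auto
qed auto

section \<open>States as arrays of bits, and the walk\<close>

type_synonym state = "bool list \<times> bool list"

text \<open>
  Cell \<open>j\<close> belongs to \<open>sender j\<close>. Cells \<open>0\<close> and \<open>1\<close> are the extra bits, and \<open>w\<^sub>t\<close> is cell \<open>t + 2\<close>,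
  so that it belongs to the sender of message \<open>t\<close>.
\<close>

definition cell :: "nat \<Rightarrow> state \<Rightarrow> bool" where
  "cell j \<omega> = (if even j then fst \<omega> else snd \<omega>) ! (j div 2)"

text \<open>Common form of the two involutions used below: one exchanges the values of
  \<open>target\<close> and reflects the walk, the other (\<open>suffix_flip\<close>) negates a
  single step.\<close>

definition toggle :: "(nat \<Rightarrow> bool) \<Rightarrow> state \<Rightarrow> state" where
  "toggle T \<omega> =
    (map (\<lambda>i. fst \<omega> ! i \<noteq> T (2 * i)) [0..<length (fst \<omega>)],
     map (\<lambda>i. snd \<omega> ! i \<noteq> T (2 * i + 1)) [0..<length (snd \<omega>)])"

definition target :: "state \<Rightarrow> real" where
  "target \<omega> = of_bool (cell 0 \<omega> \<noteq> cell 1 \<omega>)"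

text \<open>\<open>False\<close> stands for +1, which turns products of signs into equality of bits.
  The guard \<open>t \<noteq> 0\<close> replaces cell 1, an extra bit, by \<open>False\<close>, so
  that \<open>z\<^sub>0 = w\<^sub>0\<close>.\<close>

definition step :: "nat \<Rightarrow> state \<Rightarrow> real" where
  "step t \<omega> = (if (t \<noteq> 0 \<and> cell (t + 1) \<omega>) = cell (t + 2) \<omega> then 1 else -1)"

definition walk :: "nat \<Rightarrow> state \<Rightarrow> real" where
  "walk k \<omega> = (\<Sum>s<k. step s \<omega>)"

text \<open>The probability of an event whose log-odds are \<open>y\<close>.\<close>

definition logistic :: "real \<Rightarrow> real" where
  "logistic y = 1 / (1 + exp (- y))"

text \<open>One extra bit and \<open>m\<close> of the bits \<open>w\<^sub>t\<close> per agent: cells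
  are numbered below \<open>2 * m + 2\<close>, and there are \<open>2 * m\<close> tosses.\<close>

definition states :: "nat \<Rightarrow> state set" where
  "states m = {\<omega>. length (fst \<omega>) = Suc m \<and> length (snd \<omega>) = Suc m}"

lemma finite_states: "finite (states m)"
proof -
  have "states m = {x. length x = Suc m} \<times> {y. length y = Suc m}"
    by (auto simp: states_def)
  moreover have "finite {x :: bool list. length x = Suc m}"
    using finite_lists_length_eq[of "UNIV :: bool set" "Suc m"] by simp
  ultimately show ?thesis by simp
qed

lemma states_nonempty: "states m \<noteq> {}"
proof -
  have "(replicate (Suc m) False, replicate (Suc m) False) \<in> states m"
    by (simp add: states_def)
  then show ?thesis by blast
qed

lemma toggle_in_states: "\<omega> \<in> states m \<Longrightarrow> toggle T \<omega> \<in> states m"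
  by (simp add: states_def toggle_def)

lemma cell_toggle:
  assumes "\<omega> \<in> states m" "j < 2 * m + 2"
  shows "cell j (toggle T \<omega>) = (cell j \<omega> \<noteq> T j)"
proof (cases "even j")
  case True
  then have "j div 2 < Suc m" "2 * (j div 2) = j" using assms(2) by auto
  then show ?thesis using True assms(1)
    by (simp add: cell_def toggle_def states_def nth_map_upt del: upt_Suc)
next
  case False
  then have "j div 2 < Suc m" "Suc (2 * (j div 2)) = j" using assms(2) by auto
  then show ?thesis using False assms(1)
    by (simp add: cell_def toggle_def states_def nth_map_upt del: upt_Suc)
qed

lemma same_input_iff_cells:
  assumes "\<omega> \<in> states m" "\<omega>' \<in> states m"
  shows "same_input i \<omega> \<omega>' \<longleftrightarrow>
    (\<forall>j < 2 * m + 2. sender j = i \<longrightarrow> cell j \<omega> = cell j \<omega>')"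
proof (cases i)
  case Alice
  have "(\<forall>j < 2 * m + 2. sender j = Alice \<longrightarrow> cell j \<omega> = cell j \<omega>') \<longleftrightarrow>
      (\<forall>k < Suc m. fst \<omega> ! k = fst \<omega>' ! k)" (is "?L \<longleftrightarrow> ?R")
  proof
    assume ?L
    then have "cell (2 * k) \<omega> = cell (2 * k) \<omega>'" if "k < Suc m" for k
      using that by (auto simp: sender_def)
    then show ?R by (simp add: cell_def)
  qed (auto simp: sender_def cell_def split: if_splits)
  then show ?thesis
    using Alice assms by (auto simp: states_def list_eq_iff_nth_eq)
next
  case Bob
  have "(\<forall>j < 2 * m + 2. sender j = Bob \<longrightarrow> cell j \<omega> = cell j \<omega>') \<longleftrightarrow>
      (\<forall>k < Suc m. snd \<omega> ! k = snd \<omega>' ! k)" (is "?L \<longleftrightarrow> ?R")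
  proof
    assume ?L
    then have "cell (2 * k + 1) \<omega> = cell (2 * k + 1) \<omega>'" if "k < Suc m" for k
      using that by (auto simp: sender_def)
    then show ?R by (simp add: cell_def)
  qed (auto simp: sender_def cell_def split: if_splits)
  then show ?thesis
    using Bob assms by (auto simp: states_def list_eq_iff_nth_eq)
qed

lemma state_eqI:
  assumes "\<omega> \<in> states m" "\<omega>' \<in> states m" "\<And>j. j < 2 * m + 2 \<Longrightarrow> cell j \<omega> = cell j \<omega>'"
  shows "\<omega> = \<omega>'"
proof -
  have "same_input i \<omega> \<omega>'" for i
    using assms same_input_iff_cells by blast
  from this[of Alice] this[of Bob] show ?thesis by (simp add: prod_eq_iff)
qed

lemma toggle_toggle:
  assumes "\<omega> \<in> states m" shows "toggle T (toggle T \<omega>) = \<omega>"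
  by (rule state_eqI[of _ m])
    (use assms in \<open>auto simp: toggle_in_states cell_toggle[OF toggle_in_states] cell_toggle\<close>)

lemma target_toggle:
  assumes "\<omega> \<in> states m"
  shows "target (toggle T \<omega>) = (if T 0 = T 1 then target \<omega> else 1 - target \<omega>)"
  using cell_toggle[OF assms, of 0 T] cell_toggle[OF assms, of 1 T] by (auto simp: target_def)

lemma step_toggle:
  assumes "\<omega> \<in> states m" "s < 2 * m"
  shows "step s (toggle T \<omega>) = (if (s \<noteq> 0 \<and> T (s + 1)) = T (s + 2) then step s \<omega> else - step s \<omega>)"
  using cell_toggle[OF assms(1), of "s + 1" T] cell_toggle[OF assms(1), of "s + 2" T] assms(2)
  by (auto simp: step_def)

lemma step_cases: "step t \<omega> = 1 \<or> step t \<omega> = -1"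
  by (simp add: step_def)

lemma target_cases: "target \<omega> = 0 \<or> target \<omega> = 1"
  by (auto simp: target_def)

lemma walk_Suc: "walk (Suc k) \<omega> = walk k \<omega> + step k \<omega>"
  by (simp add: walk_def)

lemma abs_walk_le: "\<bar>walk k \<omega>\<bar> \<le> real k"
proof -
  have "\<bar>walk k \<omega>\<bar> \<le> (\<Sum>s<k. \<bar>step s \<omega>\<bar>)" unfolding walk_def by (rule sum_abs)
  also have "\<dots> = (\<Sum>s<k. 1)"
    by (rule sum.cong) (use step_cases in \<open>auto simp: abs_if step_def\<close>)
  also have "\<dots> = real k" by simp
  finally show ?thesis .
qed

lemma walk_eq_if_cells_eq:
  assumes "\<And>s. s < k \<Longrightarrow> cell (s + 2) \<omega>' = cell (s + 2) \<omega>"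
  shows "walk k \<omega>' = walk k \<omega>"
proof -
  have "step s \<omega>' = step s \<omega>" if "s < k" for s
    using assms[of s] assms[of "s - 1"] that by (cases s) (auto simp: step_def)
  then show ?thesis by (simp add: walk_def)
qed

text \<open>Reflection of a path at time \<open>k\<close>: the later displacement changes sign, the
  earlier one stays.\<close>

lemma walk_reflected:
  assumes "k \<le> n" and "\<And>s. s < n \<Longrightarrow> step s \<omega>' = (if s < k then step s \<omega> else - step s \<omega>)"
  shows "walk n \<omega>' = 2 * walk k \<omega> - walk n \<omega>"
  using assms
proof (induction n rule: dec_induct)
  case base
  then show ?case by (simp add: walk_def)
next
  case (step n)
  then show ?case by (simp add: walk_Suc)
qed

lemma walk_single_flip:
  assumes "t < n" and "\<And>s. s < n \<Longrightarrow> step s \<omega>' = (if s = t then - step s \<omega> else step s \<omega>)"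
  shows "walk n \<omega>' = walk n \<omega> - 2 * step t \<omega>"
proof -
  have "walk n \<omega> - walk n \<omega>' = (\<Sum>s<n. if s = t then 2 * step t \<omega> else 0)"
    unfolding walk_def sum_subtractf[symmetric] using assms(2) by (intro sum.cong) auto
  also have "\<dots> = 2 * step t \<omega>" using assms(1) by simp
  finally show ?thesis by simp
qed

section \<open>Increments of the logistic function\<close>

lemma strict_mono_logistic: "strict_mono logistic"
  by (rule strict_monoI) (simp add: logistic_def frac_less2 add_pos_pos)

lemma logistic_uminus: "logistic (- y) = 1 - logistic y"
proof -
  have "1 + exp y > 0" "1 + exp (- y) > 0" by (simp_all add: add_pos_pos)
  then show ?thesis by (simp add: logistic_def field_simps exp_minus)
qed

text \<open>The constant is the product of 1/8, from \<open>(1 + u)\<^sup>2 \<le> 8 * u\<close> (as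
  \<open>u\<close> and \<open>1 / u\<close> are at most 3), and 1/2, from
  \<open>1 - exp (- h) \<ge> h / 2\<close>.\<close>

lemma logistic_increment:
  fixes y h :: real
  assumes "\<bar>y\<bar> \<le> 1" "0 < h" "h \<le> 1"
  shows "logistic (y + h) - logistic y \<ge> h / 16"
proof -
  define u where "u = exp (- y)"
  define v where "v = exp (- h)"
  have u: "u > 0" and v: "v > 0" "v < 1" using assms by (auto simp: u_def v_def)
  have e3: "exp z \<le> 3" if "z \<le> 1" for z :: real
    using that exp_le by (meson exp_le_cancel_iff order_trans)
  have "u \<le> 3" "1 / u \<le> 3"
    using e3[of "- y"] e3[of y] assms(1) by (auto simp: u_def exp_minus inverse_eq_divide)
  then have "(1 / u + u) * u \<le> 6 * u" using u by (intro mult_right_mono) auto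
  then have sq: "(1 + u)\<^sup>2 \<le> 8 * u"
    using u by (simp add: power2_eq_square algebra_simps)
  have "exp h \<ge> 1 + h" by (rule exp_ge_add_one_self)
  then have "v \<le> 1 / (1 + h)"
    using assms(2) by (simp add: v_def exp_minus inverse_eq_divide frac_le)
  also have "\<dots> \<le> 1 - h / 2"
    using assms(2,3) mult_left_mono[of h 1 h] by (simp add: field_simps)
  finally have hv: "h / 2 \<le> 1 - v" by simp
  have "exp (- (y + h)) = u * v" by (simp add: u_def v_def flip: exp_add)
  moreover have "0 < u * v" using u v by simp
  ultimately have "logistic (y + h) - logistic y = u * (1 - v) / ((1 + u * v) * (1 + u))"
    using u by (simp add: logistic_def u_def[symmetric] diff_frac_eq algebra_simps)
  also have "\<dots> \<ge> u * (1 - v) / ((1 + u) * (1 + u))"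
  proof (rule frac_le)
    show "(1 + u * v) * (1 + u) \<le> (1 + u) * (1 + u)" using u v by (intro mult_right_mono) auto
    show "0 < (1 + u * v) * (1 + u)" using u \<open>0 < u * v\<close> by (intro mult_pos_pos) linarith+
  qed (use u v in auto)
  also have "u * (1 - v) / ((1 + u) * (1 + u)) \<ge> u * (1 - v) / (8 * u)"
    using u v sq by (intro divide_left_mono) (auto simp: power2_eq_square)
  also have "u * (1 - v) / (8 * u) = (1 - v) / 8" using u by simp
  also have "(1 - v) / 8 \<ge> h / 16" using hv by simp
  finally show ?thesis .
qed

lemma logistic_step:
  fixes y h z :: real
  assumes "\<bar>y\<bar> \<le> 1" "0 < h" "h \<le> 1" "z = 1 \<or> z = -1"
  shows "\<bar>logistic (y + h * z) - logistic y\<bar> \<ge> h / 16"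
  using assms(4)
proof
  assume "z = 1"
  then show ?thesis
    using logistic_increment[OF assms(1-3)] abs_ge_self[of "logistic (y + h) - logistic y"]
    unfolding \<open>z = 1\<close> mult_1_right by linarith
next
  \<comment> \<open>A downward step from \<open>y\<close> is an upward step from \<open>- y\<close>,
    by the symmetry \<open>logistic_uminus\<close>.\<close>
  assume z: "z = -1"
  have "logistic (- y + h) - logistic (- y) \<ge> h / 16"
    using assms by (intro logistic_increment) auto
  then have "h / 16 \<le> logistic y - logistic (y - h)"
    using logistic_uminus[of y] logistic_uminus[of "y - h"] by simp
  moreover have "y + h * z = y - h" using z by simp
  ultimately show ?thesis by (simp add: abs_if)
qed

section \<open>Estimates for the exponential and hyperbolic functions\<close>

lemma exp_quadratic_bound:
  fixes x :: real assumes "\<bar>x\<bar> \<le> 1" shows "exp x \<le> 1 + x + x\<^sup>2"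
proof (cases "x \<ge> 0")
  case True
  then show ?thesis using assms exp_bound[of x] by simp
next
  case False
  define y where "y = - x"
  have y: "0 \<le> y" using False by (simp add: y_def)
  have "exp x = 1 / exp y" by (simp add: y_def exp_minus inverse_eq_divide)
  also have "\<dots> \<le> 1 / (1 + y)" using y exp_ge_add_one_self[of y] by (intro frac_le) auto
  also have "\<dots> \<le> 1 - y + y\<^sup>2"
  proof -
    have "(1 + y) * (1 - y + y\<^sup>2) = 1 + y ^ 3" by (simp add: algebra_simps power2_eq_square power3_eq_cube)
    then show ?thesis using y by (simp add: pos_divide_le_eq mult.commute)
  qed
  finally show ?thesis by (simp add: y_def)
qed

text \<open>Controls the bias \<open>tanh \<tau>\<close> of a toss. For \<open>u \<ge> 0\<close>,
  \<open>1 - exp (- (2 * u)) \<le> 2 * u\<close> gives \<open>sinh u \<le> u * exp u\<close>, and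
  \<open>exp u \<le> 2 * cosh u\<close>.\<close>

lemma abs_sinh_le: "\<bar>sinh \<tau>\<bar> \<le> 2 * \<bar>\<tau>\<bar> * cosh (\<tau> :: real)"
proof -
  have *: "sinh u \<le> 2 * u * cosh u" if "u \<ge> 0" for u :: real
  proof -
    have "exp (- (2 * u)) \<ge> 1 - 2 * u" using exp_ge_add_one_self[of "- (2 * u)"] by simp
    then have "exp u * (1 - exp (- (2 * u))) \<le> exp u * (2 * u)" by (intro mult_left_mono) auto
    moreover have "exp u * exp (- (2 * u)) = exp (- u)" by (simp flip: exp_add)
    moreover have "0 \<le> u * exp (- u)" using that by simp
    ultimately show ?thesis by (simp add: sinh_field_def cosh_field_def algebra_simps)
  qed
  show ?thesis
  proof (cases "\<tau> \<ge> 0")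
    case True
    then show ?thesis using * by simp
  next
    case False
    then show ?thesis using *[of "- \<tau>"] by simp
  qed
qed

text \<open>\<open>cosh (\<nu> + \<tau>) / cosh \<tau>\<close> is the moment generating function at
  \<open>\<nu>\<close> of a \<plusminus>1 toss with bias \<open>tanh \<tau>\<close>; the exponent
  consists of a drift term and a variance term.\<close>

lemma cosh_add_le:
  fixes \<nu> \<tau> :: real
  assumes "\<bar>\<nu>\<bar> \<le> 1"
  shows "cosh (\<nu> + \<tau>) \<le> exp (2 * \<bar>\<tau>\<bar> * \<bar>\<nu>\<bar> + \<nu>\<^sup>2) * cosh \<tau>"
proof -
  have "exp \<tau> * exp \<nu> \<le> exp \<tau> * (1 + \<nu> + \<nu>\<^sup>2)"
    using exp_quadratic_bound[OF assms] by simp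
  moreover have "exp (- \<tau>) * exp (- \<nu>) \<le> exp (- \<tau>) * (1 - \<nu> + \<nu>\<^sup>2)"
    using exp_quadratic_bound[of "- \<nu>"] assms by simp
  moreover have "cosh (\<nu> + \<tau>) = (exp \<tau> * exp \<nu> + exp (- \<tau>) * exp (- \<nu>)) / 2"
    by (simp add: cosh_field_def add.commute flip: exp_add)
  ultimately have "cosh (\<nu> + \<tau>) \<le> cosh \<tau> * (1 + \<nu>\<^sup>2) + \<nu> * sinh \<tau>"
    by (simp add: cosh_field_def sinh_field_def field_simps)
  also have "\<nu> * sinh \<tau> \<le> \<bar>\<nu>\<bar> * (2 * \<bar>\<tau>\<bar> * cosh \<tau>)"
    using mult_left_mono[OF abs_sinh_le[of \<tau>], of "\<bar>\<nu>\<bar>"] abs_ge_self[of "\<nu> * sinh \<tau>"]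
    by (simp add: abs_mult)
  also have "cosh \<tau> * (1 + \<nu>\<^sup>2) + \<bar>\<nu>\<bar> * (2 * \<bar>\<tau>\<bar> * cosh \<tau>) =
      (1 + (2 * \<bar>\<tau>\<bar> * \<bar>\<nu>\<bar> + \<nu>\<^sup>2)) * cosh \<tau>"
    by (simp add: algebra_simps)
  also have "\<dots> \<le> exp (2 * \<bar>\<tau>\<bar> * \<bar>\<nu>\<bar> + \<nu>\<^sup>2) * cosh \<tau>"
    by (intro mult_right_mono exp_ge_add_one_self) simp
  finally show ?thesis by simp
qed

section \<open>The prior and its conditional expectations\<close>

locale coin_game =
  fixes \<theta> :: real and m :: nat
  assumes theta_pos: "\<theta> > 0"
begin

abbreviation "\<Omega> \<equiv> states m"

text \<open>
  Normalised, \<open>exp (\<plusminus>\<theta> z)\<close> is the law of one toss \<open>z\<close> of a coin with bias \<open>\<plusminus>tanh \<theta>\<close>.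
\<close>

definition weight :: "state \<Rightarrow> real" where
  "weight \<omega> = exp (\<theta> * (2 * target \<omega> - 1) * walk (2 * m) \<omega>)"

definition prior :: "state pmf" where
  "prior = embed_pmf (\<lambda>\<omega>. if \<omega> \<in> \<Omega> then weight \<omega> / sum weight \<Omega> else 0)"

lemma weight_pos: "weight \<omega> > 0"
  by (simp add: weight_def)

lemma total_weight_pos: "sum weight \<Omega> > 0"
  by (intro sum_pos finite_states states_nonempty weight_pos)

lemma pmf_prior: "pmf prior \<omega> = (if \<omega> \<in> \<Omega> then weight \<omega> / sum weight \<Omega> else 0)"
  unfolding prior_def
proof (rule pmf_embed_pmf)
  show "0 \<le> (if \<omega> \<in> \<Omega> then weight \<omega> / sum weight \<Omega> else 0)" for \<omega>
    using weight_pos[of \<omega>] total_weight_pos by simp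
  have "(\<integral>\<^sup>+ \<omega>. ennreal (if \<omega> \<in> \<Omega> then weight \<omega> / sum weight \<Omega> else 0) \<partial>count_space UNIV) =
      (\<Sum>\<omega>\<in>\<Omega>. ennreal (weight \<omega> / sum weight \<Omega>))"
    by (subst nn_integral_count_space'[of \<Omega>]) (auto simp: finite_states)
  also have "\<dots> = ennreal (\<Sum>\<omega>\<in>\<Omega>. weight \<omega> / sum weight \<Omega>)"
    using weight_pos total_weight_pos by (intro sum_ennreal) (simp add: less_imp_le)
  also have "(\<Sum>\<omega>\<in>\<Omega>. weight \<omega> / sum weight \<Omega>) = 1"
    using total_weight_pos by (simp flip: sum_divide_distrib)
  finally show "(\<integral>\<^sup>+ \<omega>. ennreal (if \<omega> \<in> \<Omega> then weight \<omega> / sum weight \<Omega> else 0) \<partial>count_space UNIV) = 1"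
    by simp
qed

lemma set_pmf_prior: "set_pmf prior = \<Omega>"
proof -
  have "pmf prior \<omega> \<noteq> 0 \<longleftrightarrow> \<omega> \<in> \<Omega>" for \<omega>
    using weight_pos[of \<omega>] total_weight_pos by (auto simp: pmf_prior)
  then show ?thesis by (auto simp: set_pmf_eq)
qed

lemma prob_prior:
  "measure_pmf.prob prior A = (\<Sum>\<omega>\<in>\<Omega> \<inter> A. weight \<omega>) / sum weight \<Omega>"
proof -
  have "measure_pmf.prob prior A = measure_pmf.prob prior (\<Omega> \<inter> A)"
    using measure_Int_set_pmf[of prior A] by (simp add: set_pmf_prior Int_commute)
  also have "\<dots> = (\<Sum>\<omega>\<in>\<Omega> \<inter> A. pmf prior \<omega>)"
    by (intro measure_measure_pmf_finite) (simp add: finite_states)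
  also have "\<dots> = (\<Sum>\<omega>\<in>\<Omega> \<inter> A. weight \<omega>) / sum weight \<Omega>"
    by (simp add: pmf_prior sum_divide_distrib)
  finally show ?thesis .
qed

lemma cond_expectation_prior:
  assumes "K \<subseteq> \<Omega>" "K \<noteq> {}"
  shows "cond_expectation prior g K = (\<Sum>\<omega>\<in>K. weight \<omega> * g \<omega>) / sum weight K"
proof -
  have ne: "set_pmf prior \<inter> K \<noteq> {}" using assms by (auto simp: set_pmf_prior)
  have fin: "finite K" using assms(1) finite_states finite_subset by blast
  have "cond_expectation prior g K = (\<Sum>\<omega>\<in>K. g \<omega> * pmf (cond_pmf prior K) \<omega>)"
    unfolding cond_expectation_def
    by (rule integral_measure_pmf_real[OF fin]) (use set_cond_pmf[OF ne] in auto)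
  also have "\<dots> = (\<Sum>\<omega>\<in>K. weight \<omega> * g \<omega> / sum weight K)"
  proof (rule sum.cong)
    fix \<omega> assume "\<omega> \<in> K"
    have "\<Omega> \<inter> K = K" using assms by auto
    then show "g \<omega> * pmf (cond_pmf prior K) \<omega> = weight \<omega> * g \<omega> / sum weight K"
      using \<open>\<omega> \<in> K\<close> assms(1) total_weight_pos
      by (auto simp: pmf_cond[OF ne] prob_prior pmf_prior)
  qed simp
  finally show ?thesis by (simp add: sum_divide_distrib)
qed

text \<open>Each state with \<open>target\<close> 1 outweighs its partner under
  \<open>\<phi>\<close> by the same factor \<open>exp (2 * \<theta> * s)\<close>, which is therefore
  the posterior odds given \<open>K\<close>.\<close>

lemma cond_expectation_involution:
  assumes K: "K \<subseteq> \<Omega>" "K \<noteq> {}"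
    and \<phi>: "\<And>\<omega>. \<omega> \<in> K \<Longrightarrow> \<phi> \<omega> \<in> K" "\<And>\<omega>. \<omega> \<in> K \<Longrightarrow> \<phi> (\<phi> \<omega>) = \<omega>"
    and target: "\<And>\<omega>. \<omega> \<in> K \<Longrightarrow> target (\<phi> \<omega>) = 1 - target \<omega>"
    and walk: "\<And>\<omega>. \<omega> \<in> K \<Longrightarrow> walk (2 * m) (\<phi> \<omega>) = 2 * s - walk (2 * m) \<omega>"
  shows "cond_expectation prior target K = logistic (2 * \<theta> * s)"
proof -
  define M where "M = (\<Sum>\<omega>\<in>K. weight \<omega> * target \<omega>)"
  have "(\<Sum>\<omega>\<in>K. weight \<omega> * (1 - target \<omega>)) = (\<Sum>\<omega>\<in>K. weight (\<phi> \<omega>) * target \<omega>)"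
    by (rule sum.reindex_bij_witness[of _ \<phi> \<phi>]) (auto simp: \<phi> target)
  also have "\<dots> = (\<Sum>\<omega>\<in>K. exp (- (2 * \<theta> * s)) * (weight \<omega> * target \<omega>))"
  proof (rule sum.cong)
    fix \<omega> assume "\<omega> \<in> K"
    then have "weight (\<phi> \<omega>) = exp (\<theta> * (2 * (1 - target \<omega>) - 1) * (2 * s - walk (2 * m) \<omega>))"
      by (simp add: weight_def target walk)
    then show "weight (\<phi> \<omega>) * target \<omega> = exp (- (2 * \<theta> * s)) * (weight \<omega> * target \<omega>)"
      using target_cases[of \<omega>]
      by (auto simp: weight_def algebra_simps simp flip: exp_add)
  qed simp
  also have "\<dots> = exp (- (2 * \<theta> * s)) * M" by (simp add: M_def sum_distrib_left)
  finally have "sum weight K = M * (1 + exp (- (2 * \<theta> * s)))"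
    by (simp add: M_def algebra_simps sum_subtractf)
  moreover have "sum weight K > 0"
    using K finite_states finite_subset by (intro sum_pos weight_pos) blast+
  moreover have "1 + exp (- (2 * \<theta> * s)) > 0" by (simp add: add_pos_pos)
  ultimately have "M > 0" "sum weight K = M * (1 + exp (- (2 * \<theta> * s)))"
    by (simp_all add: zero_less_mult_iff)
  then show ?thesis
    using K by (simp add: cond_expectation_prior M_def[symmetric] logistic_def)
qed

section \<open>Knowledge in the standard protocol\<close>

definition revealed :: "nat \<Rightarrow> agent \<Rightarrow> state \<Rightarrow> state set" where
  "revealed t i \<omega> =
    {\<omega>' \<in> \<Omega>. same_input i \<omega> \<omega>' \<and> (\<forall>s<t. cell (s + 2) \<omega>' = cell (s + 2) \<omega>)}"

text \<open>The sender of message \<open>t\<close> holds \<open>w\<^sub>t\<close> itself and is thus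
  one toss ahead of the receiver. The involution flips every bit of the other agent that
  \<open>i\<close> has not seen, its extra bit included: this swaps the values of
  \<open>target\<close> and reflects the walk at the last known time.\<close>

lemma cond_expectation_revealed:
  assumes "\<omega> \<in> \<Omega>" "t < 2 * m"
  shows "cond_expectation prior target (revealed t i \<omega>) =
    logistic (2 * \<theta> * walk (if i = sender t then Suc t else t) \<omega>)"
proof -
  define k where "k = (if i = sender t then Suc t else t)"
  \<comment> \<open>Any two consecutive cells from number \<open>k + 2\<close> on contain exactly one toggled cell, so
    \<open>toggle T\<close> negates exactly the steps from number \<open>k\<close> on.\<close>
  define T where "T j \<longleftrightarrow> sender j \<noteq> i \<and> (j < 2 \<or> k + 2 \<le> j)" for j
  let ?K = "revealed t i \<omega>"
  \<comment> \<open>\<open>w\<^sub>k\<close> is the first bit unknown to \<open>i\<close>; it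
    belongs to the other agent, so the toggling starts there.\<close>
  have sender_k: "sender k \<noteq> i" by (auto simp: k_def sender_def)
  have alt: "sender (Suc j) \<noteq> i \<longleftrightarrow> sender j = i" for j by (cases i) (auto simp: sender_def)
  have k_le: "k \<le> 2 * m" using assms(2) by (simp add: k_def)
  have "\<omega> \<in> ?K" using assms(1) by (cases i) (auto simp: revealed_def)
  have flip: "step s (toggle T \<omega>') = (if s < k then step s \<omega>' else - step s \<omega>')"
    if "\<omega>' \<in> \<Omega>" "s < 2 * m" for s \<omega>'
  proof -
    have "((s \<noteq> 0 \<and> T (s + 1)) = T (s + 2)) \<longleftrightarrow> s < k"
      using sender_k alt[of s] alt[of "Suc s"]
      by (cases s k rule: linorder_cases) (auto simp: T_def)
    then show ?thesis using step_toggle[OF that] by simp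
  qed
  have walk_const: "walk k \<omega>' = walk k \<omega>" if "\<omega>' \<in> ?K" for \<omega>'
  proof (rule walk_eq_if_cells_eq)
    fix s assume s: "s < k"
    show "cell (s + 2) \<omega>' = cell (s + 2) \<omega>"
    proof (cases "s < t")
      case True
      then show ?thesis using that by (simp add: revealed_def)
    next
      case False
      then have "s = t" "i = sender t" using s by (auto simp: k_def split: if_splits)
      then show ?thesis
        using that same_input_iff_cells[OF assms(1), of \<omega>' i] assms(2)
        by (auto simp: revealed_def sender_def)
    qed
  qed
  have "cond_expectation prior target ?K = logistic (2 * \<theta> * walk k \<omega>)"
  proof (rule cond_expectation_involution[where \<phi> = "toggle T"])
    show "?K \<subseteq> \<Omega>" by (auto simp: revealed_def)
    show "?K \<noteq> {}" using \<open>\<omega> \<in> ?K\<close> by blast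
    fix \<omega>' assume \<omega>': "\<omega>' \<in> ?K"
    then have \<Omega>': "\<omega>' \<in> \<Omega>" by (simp add: revealed_def)
    show "toggle T (toggle T \<omega>') = \<omega>'" by (rule toggle_toggle[OF \<Omega>'])
    show "target (toggle T \<omega>') = 1 - target \<omega>'"
      using target_toggle[OF \<Omega>'] alt[of 0] by (auto simp: T_def)
    show "walk (2 * m) (toggle T \<omega>') = 2 * walk k \<omega> - walk (2 * m) \<omega>'"
      using walk_reflected[OF k_le flip[OF \<Omega>']] walk_const[OF \<omega>'] by simp
    have "same_input i \<omega> (toggle T \<omega>')"
      using \<omega>' assms(1) \<Omega>' toggle_in_states[OF \<Omega>']
      by (auto simp: revealed_def same_input_iff_cells cell_toggle T_def)
    moreover have "cell (s + 2) (toggle T \<omega>') = cell (s + 2) \<omega>" if "s < t" for s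
    proof -
      have "\<not> T (s + 2)" using that by (auto simp: T_def k_def split: if_splits)
      then show ?thesis
        using \<omega>' that assms(2) cell_toggle[OF \<Omega>', of "s + 2" T] by (simp add: revealed_def)
    qed
    ultimately show "toggle T \<omega>' \<in> ?K"
      using toggle_in_states[OF \<Omega>'] by (simp add: revealed_def)
  qed
  then show ?thesis by (simp add: k_def)
qed

abbreviation "std \<equiv> standard_protocol prior target"

text \<open>Since \<open>logistic\<close> is strictly increasing and \<open>\<theta> > 0\<close>, a
  message determines \<open>walk (Suc t)\<close>. As \<open>walk t\<close> is already known, it
  reveals the toss \<open>z\<^sub>t\<close>, hence \<open>w\<^sub>t\<close>, and nothing
  more.\<close>

lemma knowledge_std:
  assumes "\<omega> \<in> \<Omega>" "t \<le> 2 * m"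
  shows "knowledge \<Omega> std t i \<omega> = revealed t i \<omega>"
  using assms
proof (induction t arbitrary: i \<omega>)
  case 0
  then show ?case by (simp add: revealed_def)
next
  case (Suc t)
  have msg: "std t (knowledge \<Omega> std t (sender t) \<omega>') = logistic (2 * \<theta> * walk (Suc t) \<omega>')"
    if "\<omega>' \<in> \<Omega>" for \<omega>'
    unfolding Suc.IH[OF that Suc_leD[OF Suc.prems(2)]] standard_protocol_def[of _ _ t]
    using cond_expectation_revealed[OF that, of t "sender t"] Suc.prems(2) by simp
  have IH: "knowledge \<Omega> std t i \<omega> = revealed t i \<omega>" using Suc by simp
  show ?case
  proof (cases "i = sender t")
    case True
    \<comment> \<open>The bit \<open>w\<^sub>t\<close> is part of the sender's own input, so the new
      constraint already holds.\<close>
    have "cell (t + 2) \<omega>' = cell (t + 2) \<omega>" if "\<omega>' \<in> revealed t i \<omega>" for \<omega>'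
      using that same_input_iff_cells[OF Suc.prems(1), of \<omega>' i] Suc.prems(2) True
      by (auto simp: revealed_def sender_def)
    then have "revealed (Suc t) i \<omega> = revealed t i \<omega>"
      by (auto simp: revealed_def less_Suc_eq)
    then show ?thesis using True IH by simp
  next
    case False
    have "std t (knowledge \<Omega> std t (sender t) \<omega>') = std t (knowledge \<Omega> std t (sender t) \<omega>) \<longleftrightarrow>
        cell (t + 2) \<omega>' = cell (t + 2) \<omega>" if "\<omega>' \<in> revealed t i \<omega>" for \<omega>'
    proof -
      have \<Omega>': "\<omega>' \<in> \<Omega>" and cells: "\<And>s. s < t \<Longrightarrow> cell (s + 2) \<omega>' = cell (s + 2) \<omega>"
        using that by (auto simp: revealed_def)
      have "walk t \<omega>' = walk t \<omega>" by (rule walk_eq_if_cells_eq[OF cells])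
      then have "std t (knowledge \<Omega> std t (sender t) \<omega>') = std t (knowledge \<Omega> std t (sender t) \<omega>)
          \<longleftrightarrow> step t \<omega>' = step t \<omega>"
        using msg[OF \<Omega>'] msg[OF Suc.prems(1)] strict_mono_eq[OF strict_mono_logistic] theta_pos
        by (simp add: walk_Suc)
      \<comment> \<open>Given \<open>w\<^sub>t\<^sub>-\<^sub>1\<close>, the product
        \<open>z\<^sub>t\<close> determines \<open>w\<^sub>t\<close>; for \<open>t = 0\<close> the
        two coincide.\<close>
      also have "\<dots> \<longleftrightarrow> cell (t + 2) \<omega>' = cell (t + 2) \<omega>"
        using cells[of "t - 1"] by (cases t) (auto simp: step_def)
      finally show ?thesis .
    qed
    moreover have "revealed (Suc t) i \<omega> = {\<omega>' \<in> revealed t i \<omega>. cell (t + 2) \<omega>' = cell (t + 2) \<omega>}"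
      by (auto simp: revealed_def less_Suc_eq)
    moreover have "revealed t i \<omega> \<subseteq> \<Omega>" by (auto simp: revealed_def)
    ultimately show ?thesis using False IH by auto
  qed
qed

lemma agent_expectation_std:
  assumes "\<omega> \<in> \<Omega>" "t < 2 * m"
  shows "agent_expectation \<Omega> prior target std i t \<omega> =
    logistic (2 * \<theta> * walk (if i = sender t then Suc t else t) \<omega>)"
  using assms by (simp add: agent_expectation_def knowledge_std cond_expectation_revealed)

lemma message_std:
  assumes "\<omega> \<in> \<Omega>" "t < 2 * m"
  shows "message \<Omega> std t \<omega> = logistic (2 * \<theta> * walk (Suc t) \<omega>)"
  unfolding message_def knowledge_std[OF assms(1) less_imp_le[OF assms(2)]]
    standard_protocol_def[of _ _ t]
  using assms by (simp add: cond_expectation_revealed)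

text \<open>The arguments of \<open>logistic\<close> for the two agents are one toss apart, so
  \<open>logistic_step\<close> applies with \<open>h = 2 * \<theta>\<close>.\<close>

lemma disagree_std:
  assumes "\<omega> \<in> \<Omega>" "t < 2 * m" "\<theta> \<le> 1 / 2" "2 * \<theta> * \<bar>walk t \<omega>\<bar> \<le> 1"
  shows "\<bar>agent_expectation \<Omega> prior target std Alice t \<omega> -
    agent_expectation \<Omega> prior target std Bob t \<omega>\<bar> \<ge> \<theta> / 8"
proof -
  have "\<bar>logistic (2 * \<theta> * walk t \<omega> + 2 * \<theta> * step t \<omega>) - logistic (2 * \<theta> * walk t \<omega>)\<bar> \<ge> 2 * \<theta> / 16"
    using assms theta_pos step_cases[of t \<omega>]
    by (intro logistic_step) (auto simp: abs_mult)
  then have "\<bar>logistic (2 * \<theta> * walk (Suc t) \<omega>) - logistic (2 * \<theta> * walk t \<omega>)\<bar> \<ge> \<theta> / 8"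
    by (simp add: walk_Suc algebra_simps)
  then show ?thesis
    using assms by (cases "even t") (auto simp: agent_expectation_std sender_def abs_minus_commute)
qed

section \<open>Negating one toss, and the length of codes\<close>

definition suffix_flip :: "nat \<Rightarrow> state \<Rightarrow> state" where
  "suffix_flip t = toggle (\<lambda>j. t + 2 \<le> j)"

lemma suffix_flip:
  assumes "\<omega> \<in> \<Omega>"
  shows "suffix_flip t \<omega> \<in> \<Omega>" "suffix_flip t (suffix_flip t \<omega>) = \<omega>"
    "target (suffix_flip t \<omega>) = target \<omega>"
  using assms by (simp_all add: suffix_flip_def toggle_in_states toggle_toggle target_toggle)

text \<open>Each later step is a product of two flipped bits; only step \<open>t\<close> has exactly
  one flipped factor.\<close>

lemma step_suffix_flip:
  assumes "\<omega> \<in> \<Omega>" "s < 2 * m"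
  shows "step s (suffix_flip t \<omega>) = (if s = t then - step s \<omega> else step s \<omega>)"
  using step_toggle[OF assms] by (auto simp: suffix_flip_def)

lemma message_std_nonconstant:
  assumes "t < 2 * m" "\<omega> \<in> \<Omega>"
  shows "\<exists>\<omega>'\<in>\<Omega>. message \<Omega> std t \<omega>' \<noteq> message \<Omega> std t \<omega>"
proof
  let ?\<omega>' = "suffix_flip t \<omega>"
  show "?\<omega>' \<in> \<Omega>" by (rule suffix_flip[OF assms(2)])
  have "walk (Suc t) ?\<omega>' = walk (Suc t) \<omega> - 2 * step t \<omega>"
    using assms by (intro walk_single_flip) (auto simp: step_suffix_flip)
  then have "walk (Suc t) ?\<omega>' \<noteq> walk (Suc t) \<omega>" using step_cases[of t \<omega>] by auto
  then show "message \<Omega> std t ?\<omega>' \<noteq> message \<Omega> std t \<omega>"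
    using assms \<open>?\<omega>' \<in> \<Omega>\<close> strict_mono_eq[OF strict_mono_logistic] theta_pos
    by (simp add: message_std)
qed

text \<open>The empty word is a prefix of every word, so a prefix-free code for a message with at
  least two values never uses it. Each of the first \<open>2 * m\<close> messages therefore costs a
  bit in every state.\<close>

lemma bits_sent_std:
  assumes "valid_encoding \<Omega> std enc" "\<omega> \<in> \<Omega>"
  shows "bits_sent \<Omega> std enc t \<omega> \<ge> min t (2 * m)"
proof -
  have pos: "length (enc k (message \<Omega> std k \<omega>)) \<ge> 1" if k: "k < 2 * m" for k
  proof -
    obtain \<omega>' where "\<omega>' \<in> \<Omega>" "message \<Omega> std k \<omega>' \<noteq> message \<Omega> std k \<omega>"
      using message_std_nonconstant[OF k assms(2)] by blast
    then have "\<not> prefix (enc k (message \<Omega> std k \<omega>)) (enc k (message \<Omega> std k \<omega>'))"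
      using assms by (auto simp: valid_encoding_def prefix_free_on_def)
    then have "enc k (message \<Omega> std k \<omega>) \<noteq> []" by auto
    then show ?thesis by (simp add: Suc_le_eq)
  qed
  have "min t (2 * m) = (\<Sum>k<min t (2 * m). 1)" by simp
  also have "\<dots> \<le> (\<Sum>k<min t (2 * m). length (enc k (message \<Omega> std k \<omega>)))"
    by (intro sum_mono pos) simp
  also have "\<dots> \<le> bits_sent \<Omega> std enc t \<omega>"
    unfolding bits_sent_def by (intro sum_mono2) auto
  finally show ?thesis .
qed

section \<open>Exponential moments and the Chernoff bound\<close>

lemma exp_moment_step:
  assumes "t < 2 * m" "\<bar>\<nu>\<bar> \<le> 1"
  shows "(\<Sum>\<omega>\<in>\<Omega>. weight \<omega> * exp (\<nu> * walk (Suc t) \<omega>)) \<le>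
    exp (2 * \<theta> * \<bar>\<nu>\<bar> + \<nu>\<^sup>2) * (\<Sum>\<omega>\<in>\<Omega>. weight \<omega> * exp (\<nu> * walk t \<omega>))"
proof -
  define \<sigma> where "\<sigma> \<omega> = \<theta> * (2 * target \<omega> - 1)" for \<omega>
  \<comment> \<open>\<open>r\<close> removes the factor of toss \<open>t\<close> from the weight,
    which makes it invariant under \<open>suffix_flip t\<close>.\<close>
  define r where "r \<omega> = weight \<omega> * exp (\<nu> * walk t \<omega>) * exp (- (\<sigma> \<omega> * step t \<omega>))" for \<omega>
  have abs_\<sigma>: "\<bar>\<sigma> \<omega>\<bar> = \<theta>" for \<omega> using target_cases[of \<omega>] theta_pos by (auto simp: \<sigma>_def)
  have weight_flip: "weight (suffix_flip t \<omega>) = weight \<omega> * exp (- 2 * (\<sigma> \<omega> * step t \<omega>))"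
    and walk_flip: "walk t (suffix_flip t \<omega>) = walk t \<omega>"
    and step_flip: "step t (suffix_flip t \<omega>) = - step t \<omega>" if "\<omega> \<in> \<Omega>" for \<omega>
  proof -
    have "walk (2 * m) (suffix_flip t \<omega>) = walk (2 * m) \<omega> - 2 * step t \<omega>"
      using assms(1) that by (intro walk_single_flip) (auto simp: step_suffix_flip)
    then have eq: "weight (suffix_flip t \<omega>) = exp (\<sigma> \<omega> * (walk (2 * m) \<omega> - 2 * step t \<omega>))"
      using that by (simp add: weight_def suffix_flip \<sigma>_def)
    show "weight (suffix_flip t \<omega>) = weight \<omega> * exp (- 2 * (\<sigma> \<omega> * step t \<omega>))"
      unfolding eq by (simp add: weight_def \<sigma>_def algebra_simps flip: exp_add)
    show "walk t (suffix_flip t \<omega>) = walk t \<omega>"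
      unfolding walk_def using assms(1) that by (intro sum.cong) (auto simp: step_suffix_flip)
    show "step t (suffix_flip t \<omega>) = - step t \<omega>"
      using assms(1) that by (simp add: step_suffix_flip)
  qed
  \<comment> \<open>Averaging over each pair \<open>\<omega>\<close>,
    \<open>suffix_flip t \<omega>\<close> turns the factor of the toss into a hyperbolic cosine. The
    moment at time \<open>Suc t\<close> is the case \<open>\<mu> = \<nu>\<close>, the one at time
    \<open>t\<close> the case \<open>\<mu> = 0\<close>; \<open>cosh_add_le\<close> compares
    them.\<close>
  have symm: "(\<Sum>\<omega>\<in>\<Omega>. weight \<omega> * (exp (\<nu> * walk t \<omega>) * exp (\<mu> * step t \<omega>))) =
      (\<Sum>\<omega>\<in>\<Omega>. r \<omega> * cosh (\<mu> + \<sigma> \<omega>))" for \<mu>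
  proof -
    let ?F = "\<lambda>\<omega>. weight \<omega> * (exp (\<nu> * walk t \<omega>) * exp (\<mu> * step t \<omega>))"
    have "sum ?F \<Omega> = (\<Sum>\<omega>\<in>\<Omega>. ?F (suffix_flip t \<omega>))"
      by (rule sum.reindex_bij_witness[of _ "suffix_flip t" "suffix_flip t"]) (auto simp: suffix_flip)
    then have "2 * sum ?F \<Omega> = (\<Sum>\<omega>\<in>\<Omega>. ?F \<omega> + ?F (suffix_flip t \<omega>))"
      by (simp add: sum.distrib)
    also have "\<dots> = (\<Sum>\<omega>\<in>\<Omega>. 2 * (r \<omega> * cosh (\<mu> + \<sigma> \<omega>)))"
    proof (rule sum.cong)
      fix \<omega> assume "\<omega> \<in> \<Omega>"
      then show "?F \<omega> + ?F (suffix_flip t \<omega>) = 2 * (r \<omega> * cosh (\<mu> + \<sigma> \<omega>))"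
        using step_cases[of t \<omega>]
        by (auto simp: weight_flip walk_flip step_flip r_def cosh_field_def algebra_simps
            simp flip: exp_add)
    qed simp
    finally show ?thesis by (simp flip: sum_distrib_left)
  qed
  have "(\<Sum>\<omega>\<in>\<Omega>. weight \<omega> * exp (\<nu> * walk (Suc t) \<omega>)) = (\<Sum>\<omega>\<in>\<Omega>. r \<omega> * cosh (\<nu> + \<sigma> \<omega>))"
    using symm[of \<nu>] by (simp add: walk_Suc distrib_left exp_add)
  also have "\<dots> \<le> (\<Sum>\<omega>\<in>\<Omega>. r \<omega> * (exp (2 * \<theta> * \<bar>\<nu>\<bar> + \<nu>\<^sup>2) * cosh (\<sigma> \<omega>)))"
  proof (intro sum_mono mult_left_mono)
    show "cosh (\<nu> + \<sigma> \<omega>) \<le> exp (2 * \<theta> * \<bar>\<nu>\<bar> + \<nu>\<^sup>2) * cosh (\<sigma> \<omega>)" for \<omega>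
      using cosh_add_le[OF assms(2), of "\<sigma> \<omega>"] by (simp add: abs_\<sigma>)
    show "0 \<le> r \<omega>" for \<omega> using weight_pos[of \<omega>] by (simp add: r_def)
  qed
  also have "\<dots> = exp (2 * \<theta> * \<bar>\<nu>\<bar> + \<nu>\<^sup>2) * (\<Sum>\<omega>\<in>\<Omega>. r \<omega> * cosh (0 + \<sigma> \<omega>))"
    unfolding sum_distrib_left by (rule sum.cong) (simp_all add: mult_ac)
  also have "(\<Sum>\<omega>\<in>\<Omega>. r \<omega> * cosh (0 + \<sigma> \<omega>)) = (\<Sum>\<omega>\<in>\<Omega>. weight \<omega> * exp (\<nu> * walk t \<omega>))"
    using symm[of 0] by simp
  finally show ?thesis .
qed

lemma exp_moment:
  assumes "t \<le> 2 * m" "\<bar>\<nu>\<bar> \<le> 1"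
  shows "(\<Sum>\<omega>\<in>\<Omega>. weight \<omega> * exp (\<nu> * walk t \<omega>)) \<le>
    exp (real t * (2 * \<theta> * \<bar>\<nu>\<bar> + \<nu>\<^sup>2)) * sum weight \<Omega>"
  using assms(1)
proof (induction t)
  case 0
  then show ?case by (simp add: walk_def)
next
  case (Suc t)
  let ?e = "2 * \<theta> * \<bar>\<nu>\<bar> + \<nu>\<^sup>2"
  have "(\<Sum>\<omega>\<in>\<Omega>. weight \<omega> * exp (\<nu> * walk (Suc t) \<omega>)) \<le>
      exp ?e * (\<Sum>\<omega>\<in>\<Omega>. weight \<omega> * exp (\<nu> * walk t \<omega>))"
    using Suc.prems assms(2) by (intro exp_moment_step) auto
  also have "\<dots> \<le> exp ?e * (exp (real t * ?e) * sum weight \<Omega>)"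
    using Suc by (intro mult_left_mono) auto
  also have "\<dots> = exp (real (Suc t) * ?e) * sum weight \<Omega>"
    by (simp add: distrib_right exp_add)
  finally show ?case .
qed

text \<open>Markov's inequality for the sum of the exponentials with \<open>\<nu>\<close> and
  \<open>- \<nu>\<close>, which treats both tails at once and yields the factor 2.\<close>

lemma prob_walk_large_chernoff:
  assumes "t \<le> 2 * m" "0 \<le> \<nu>" "\<nu> \<le> 1"
  shows "measure_pmf.prob prior {\<omega>. \<bar>walk t \<omega>\<bar> > R} \<le>
    2 * exp (real t * (2 * \<theta> * \<nu> + \<nu>\<^sup>2) - \<nu> * R)"
proof -
  let ?e = "real t * (2 * \<theta> * \<nu> + \<nu>\<^sup>2)" and ?B = "\<Omega> \<inter> {\<omega>. \<bar>walk t \<omega>\<bar> > R}"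
  have markov: "1 \<le> exp (- (\<nu> * R)) * (exp (\<nu> * walk t \<omega>) + exp ((- \<nu>) * walk t \<omega>))"
    if "\<bar>walk t \<omega>\<bar> > R" for \<omega>
  proof -
    have "\<nu> * R \<le> \<nu> * \<bar>walk t \<omega>\<bar>" using assms(2) that by (intro mult_left_mono) auto
    then have "exp (\<nu> * R) \<le> exp (\<nu> * \<bar>walk t \<omega>\<bar>)" by simp
    also have "\<dots> \<le> exp (\<nu> * walk t \<omega>) + exp ((- \<nu>) * walk t \<omega>)"
      by (cases "walk t \<omega> \<ge> 0") auto
    finally show ?thesis by (simp add: exp_minus field_simps)
  qed
  have "sum weight ?B \<le>
      (\<Sum>\<omega>\<in>?B. weight \<omega> * (exp (- (\<nu> * R)) * (exp (\<nu> * walk t \<omega>) + exp ((- \<nu>) * walk t \<omega>))))"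
  proof (rule sum_mono)
    fix \<omega> assume "\<omega> \<in> ?B"
    then show "weight \<omega> \<le> weight \<omega> * (exp (- (\<nu> * R)) * (exp (\<nu> * walk t \<omega>) + exp ((- \<nu>) * walk t \<omega>)))"
      using mult_left_mono[OF markov, of \<omega> "weight \<omega>"] weight_pos[of \<omega>] by simp
  qed
  also have "\<dots> \<le>
      (\<Sum>\<omega>\<in>\<Omega>. weight \<omega> * (exp (- (\<nu> * R)) * (exp (\<nu> * walk t \<omega>) + exp ((- \<nu>) * walk t \<omega>))))"
    using weight_pos
    by (intro sum_mono2 finite_states) (auto intro!: mult_nonneg_nonneg simp: less_imp_le)
  also have "\<dots> = exp (- (\<nu> * R)) * ((\<Sum>\<omega>\<in>\<Omega>. weight \<omega> * exp (\<nu> * walk t \<omega>)) +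
      (\<Sum>\<omega>\<in>\<Omega>. weight \<omega> * exp ((- \<nu>) * walk t \<omega>)))"
    by (simp add: sum_distrib_left sum.distrib algebra_simps)
  also have "\<dots> \<le> exp (- (\<nu> * R)) * (exp ?e * sum weight \<Omega> + exp ?e * sum weight \<Omega>)"
    using exp_moment[OF assms(1), of \<nu>] exp_moment[OF assms(1), of "- \<nu>"] assms(2,3)
    by (intro mult_left_mono add_mono) auto
  also have "\<dots> = 2 * exp (?e - \<nu> * R) * sum weight \<Omega>"
    by (simp add: exp_diff exp_minus field_simps)
  finally show ?thesis
    using total_weight_pos by (simp add: prob_prior pos_divide_le_eq)
qed

text \<open>The last hypothesis bounds the drift part of the exponent by
  \<open>\<nu> * R / 2\<close>; the remaining \<open>t * \<nu>\<^sup>2 - \<nu> * R / 2\<close> is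
  least at \<open>\<nu> = R / (4 * t)\<close>.\<close>

lemma prob_walk_large:
  assumes "t \<le> 2 * m" "0 < t" "0 < R" "4 * \<theta> * real t \<le> R"
  shows "measure_pmf.prob prior {\<omega>. \<bar>walk t \<omega>\<bar> > R} \<le> 2 * exp (- (R\<^sup>2 / (16 * real t)))"
proof (cases "real t < R")
  case True
  \<comment> \<open>The walk cannot exceed \<open>R\<close> this early; excluding this case ensures
    \<open>\<nu> \<le> 1\<close> below.\<close>
  then have "\<not> \<bar>walk t \<omega>\<bar> > R" for \<omega> using abs_walk_le[of t \<omega>] by linarith
  then show ?thesis by simp
next
  case False
  define \<nu> where "\<nu> = R / (4 * real t)"
  have \<nu>: "0 \<le> \<nu>" "\<nu> \<le> 1" using False assms by (auto simp: \<nu>_def)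
  have "real t * (2 * \<theta> * \<nu> + \<nu>\<^sup>2) - \<nu> * R = \<nu> * (4 * \<theta> * real t) / 2 + real t * \<nu>\<^sup>2 - \<nu> * R"
    by (simp add: algebra_simps)
  also have "\<dots> \<le> \<nu> * R / 2 + real t * \<nu>\<^sup>2 - \<nu> * R"
    using mult_left_mono[OF assms(4) \<nu>(1)] by linarith
  also have "\<dots> = - (R\<^sup>2 / (16 * real t))"
    using assms(2) by (simp add: \<nu>_def field_simps power2_eq_square)
  finally have "2 * exp (real t * (2 * \<theta> * \<nu> + \<nu>\<^sup>2) - \<nu> * R) \<le> 2 * exp (- (R\<^sup>2 / (16 * real t)))"
    by simp
  then show ?thesis using prob_walk_large_chernoff[OF assms(1) \<nu>, of R] by linarith
qed

section \<open>Exchange of the two extra bits\<close>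

definition exchange :: "(bool list, bool list, bool list) protocol" where
  "exchange t K = [cell t (SOME \<omega>. \<omega> \<in> K)]"

text \<open>Cell \<open>t\<close> is part of the input of \<open>sender t\<close>, so all states in
  its knowledge set agree on it and the arbitrary choice in \<open>exchange\<close> does not
  matter.\<close>

lemma message_exchange:
  assumes "\<omega> \<in> \<Omega>" shows "message \<Omega> exchange t \<omega> = [cell t \<omega>]"
proof -
  let ?K = "knowledge \<Omega> exchange t (sender t) \<omega>"
  have "(SOME \<omega>'. \<omega>' \<in> ?K) \<in> ?K" using knowledge_refl[OF assms] by (rule someI)
  then have "same_input (sender t) \<omega> (SOME \<omega>'. \<omega>' \<in> ?K)" using knowledge_same_input by blast
  then show ?thesis by (auto simp: message_def exchange_def cell_def sender_def split: if_splits)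
qed

lemma agent_expectation_exchange:
  assumes "\<omega> \<in> \<Omega>" shows "agent_expectation \<Omega> prior target exchange i 2 \<omega> = target \<omega>"
proof -
  let ?K = "knowledge \<Omega> exchange 2 i \<omega>"
  have const: "target \<omega>' = target \<omega>" if \<omega>': "\<omega>' \<in> ?K" for \<omega>'
  proof -
    have \<Omega>': "\<omega>' \<in> \<Omega>" and same: "same_input i \<omega> \<omega>'"
      using knowledge_same_input[OF \<omega>'] by auto
    \<comment> \<open>The other agent's extra bit is message 1 for Alice and message 0 for
      Bob.\<close>
    have "message \<Omega> exchange (if i = Alice then 1 else 0) \<omega>' =
        message \<Omega> exchange (if i = Alice then 1 else 0) \<omega>"
      using \<omega>' unfolding message_def
      by (cases i) (auto simp: numeral_2_eq_2 sender_def simp del: knowledge.simps(1))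
    then show ?thesis
      using same \<Omega>' assms by (cases i) (auto simp: message_exchange target_def cell_def)
  qed
  have K: "?K \<subseteq> \<Omega>" "?K \<noteq> {}"
    using knowledge_same_input knowledge_refl[OF assms] by blast+
  then have "sum weight ?K > 0"
    using finite_subset[OF K(1) finite_states] by (intro sum_pos weight_pos)
  moreover have "(\<Sum>\<omega>'\<in>?K. weight \<omega>' * target \<omega>') = sum weight ?K * target \<omega>"
    by (simp add: const sum_distrib_right)
  ultimately show ?thesis
    using K by (simp add: agent_expectation_def cond_expectation_prior)
qed

lemma agree_exchange:
  assumes "\<epsilon> > 0" "\<delta> > 0" shows "agree_after \<Omega> prior target exchange \<epsilon> \<delta> 2"
proof -
  have "measure_pmf.prob prior {\<omega>. \<bar>agent_expectation \<Omega> prior target exchange Alice 2 \<omega> -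
      agent_expectation \<Omega> prior target exchange Bob 2 \<omega>\<bar> > \<epsilon>} = 0"
    using assms(1) by (subst measure_pmf_zero_iff)
      (auto simp: set_pmf_prior agent_expectation_exchange)
  then show ?thesis using assms(2) by (simp add: agree_after_def)
qed

section \<open>Lower bounds for the standard protocol\<close>

lemma agree_std_imp_walk_large:
  assumes agree: "agree_after \<Omega> prior target std \<epsilon> \<delta> t"
    and "t < 2 * m" "\<theta> \<le> 1 / 2" "\<epsilon> < \<theta> / 8"
  shows "1 - \<delta> \<le> measure_pmf.prob prior {\<omega>. \<bar>walk t \<omega>\<bar> > 1 / (2 * \<theta>)}"
proof -
  let ?B = "{\<omega>. \<bar>walk t \<omega>\<bar> > 1 / (2 * \<theta>)}"
  let ?D = "{\<omega>. \<bar>agent_expectation \<Omega> prior target std Alice t \<omega> -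
    agent_expectation \<Omega> prior target std Bob t \<omega>\<bar> > \<epsilon>}"
  \<comment> \<open>Off \<open>?B\<close> the expectations differ by at least
    \<open>\<theta> / 8 > \<epsilon>\<close>, so agreement leaves \<open>- ?B\<close> probability at
    most \<open>\<delta>\<close>.\<close>
  have "\<Omega> \<inter> - ?B \<subseteq> ?D"
  proof
    fix \<omega> assume \<omega>: "\<omega> \<in> \<Omega> \<inter> - ?B"
    then have "2 * \<theta> * \<bar>walk t \<omega>\<bar> \<le> 1" using theta_pos by (simp add: field_simps not_less)
    then show "\<omega> \<in> ?D" using disagree_std[of \<omega> t] \<omega> assms by auto
  qed
  then have "measure_pmf.prob prior (\<Omega> \<inter> - ?B) \<le> measure_pmf.prob prior ?D"
    by (intro measure_pmf.finite_measure_mono) auto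
  moreover have "measure_pmf.prob prior (- ?B) = measure_pmf.prob prior (\<Omega> \<inter> - ?B)"
    using measure_Int_set_pmf[of prior "- ?B"] by (simp add: set_pmf_prior Int_commute)
  ultimately have "measure_pmf.prob prior (- ?B) \<le> measure_pmf.prob prior ?D" by simp
  also have "\<dots> \<le> \<delta>" using agree by (simp add: agree_after_def)
  finally show ?thesis using measure_pmf.prob_compl[of ?B prior] by (simp add: Compl_eq_Diff_UNIV)
qed

text \<open>With \<open>\<theta> = 16 * \<epsilon>\<close> the gap \<open>\<theta> / 8\<close> is
  twice \<open>\<epsilon>\<close>. The threshold is \<open>R = 1 / (32 * \<epsilon>)\<close> and the
  Chernoff exponent \<open>R\<^sup>2 / (16 * t)\<close> is
  \<open>1 / (16384 * \<epsilon>\<^sup>2 * t)\<close>; with fewer messages than claimed it exceeds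
  \<open>L\<close>, which makes a large walk less likely than \<open>1 - \<delta>\<close>.\<close>

lemma messages_std_lower_bound:
  assumes agree: "agree_after \<Omega> prior target std \<epsilon> \<delta> t"
    and \<epsilon>: "0 < \<epsilon>" "\<epsilon> \<le> 1 / 32" "\<theta> = 16 * \<epsilon>" and m: "1 / \<epsilon>\<^sup>2 \<le> real (2 * m)"
    and \<delta>: "0 < \<delta>" "\<delta> < 1"
  shows "real t \<ge> 1 / 16384 * (1 / (\<epsilon>\<^sup>2 * log 2 (2 / ((1 - \<delta>) * \<epsilon>))))"
proof (rule ccontr)
  define p where "p = 1 - \<delta>"
  define L where "L = log 2 (2 / (p * \<epsilon>))"
  have p: "0 < p" "p < 1" using \<delta> by (auto simp: p_def)
  have p\<epsilon>: "0 < p * \<epsilon>" "p * \<epsilon> \<le> 1" using p \<epsilon> by (auto simp: mult_le_one)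
  have "log 2 2 \<le> L" unfolding L_def using p\<epsilon> by (subst log_le_cancel_iff) (auto simp: field_simps)
  then have L: "1 \<le> L" by simp
  assume "\<not> ?thesis"
  then have "real t < 1 / 16384 * (1 / (\<epsilon>\<^sup>2 * L))" by (simp add: p_def L_def)
  then have tL: "16384 * \<epsilon>\<^sup>2 * real t * L < 1" using \<epsilon>(1) L by (simp add: field_simps)
  \<comment> \<open>As \<open>L \<ge> 1\<close>, the negated bound keeps \<open>t\<close> below
    \<open>2 * m\<close> and the drift \<open>4 * \<theta> * t\<close> below
    \<open>R\<close>.\<close>
  have "16384 * \<epsilon>\<^sup>2 * real t * 1 \<le> 16384 * \<epsilon>\<^sup>2 * real t * L" using L by (intro mult_left_mono) auto
  then have t: "16384 * \<epsilon>\<^sup>2 * real t < 1" using tL by simp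
  then have "real t < 1 / \<epsilon>\<^sup>2" using \<epsilon>(1) by (simp add: field_simps)
  then have tm: "t < 2 * m" using m by linarith
  have large: "p \<le> measure_pmf.prob prior {\<omega>. \<bar>walk t \<omega>\<bar> > 1 / (2 * \<theta>)}"
    unfolding p_def using \<epsilon> by (intro agree_std_imp_walk_large[OF agree tm]) auto
  \<comment> \<open>The Chernoff bound divides by \<open>t\<close>; at time 0 the walk has not
    moved, so it cannot be large.\<close>
  have "t \<noteq> 0"
  proof
    assume "t = 0"
    then have "\<not> \<bar>walk t \<omega>\<bar> > 1 / (2 * \<theta>)" for \<omega>
      using theta_pos by (simp add: walk_def not_less)
    then show False using large p by simp
  qed
  have "measure_pmf.prob prior {\<omega>. \<bar>walk t \<omega>\<bar> > 1 / (2 * \<theta>)} \<le>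
      2 * exp (- ((1 / (2 * \<theta>))\<^sup>2 / (16 * real t)))"
  proof (rule prob_walk_large)
    show "4 * \<theta> * real t \<le> 1 / (2 * \<theta>)"
      using t \<epsilon> by (simp add: field_simps power2_eq_square)
  qed (use tm \<open>t \<noteq> 0\<close> theta_pos in auto)
  also have "\<dots> \<le> 2 * exp (- L)"
    using tL \<open>t \<noteq> 0\<close> \<epsilon> by (simp add: field_simps power2_eq_square)
  \<comment> \<open>Passing to base 2, at no cost since \<open>ln 2 < 1\<close>, makes the bound
    equal to \<open>p * \<epsilon>\<close>.\<close>
  also have "\<dots> \<le> 2 * 2 powr (- L)"
  proof -
    have "L * ln 2 \<le> L * 1" using L ln_2_less_1 by (intro mult_left_mono) auto
    then show ?thesis by (simp add: powr_def)
  qed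
  also have "\<dots> = p * \<epsilon>" using p\<epsilon> by (simp add: L_def powr_minus)
  also have "\<dots> < p" using p \<epsilon> by simp
  finally show False using large by simp
qed

text \<open>At \<open>\<delta> = 1 / 2\<close> the logarithm is \<open>2 + ?l\<close> with
  \<open>?l \<ge> 5\<close>, hence at most \<open>2 * ?l\<close>; this halves the constant.\<close>

lemma bits_std_lower_bound:
  assumes agree: "agree_after \<Omega> prior target std \<epsilon> (1 / 2) t"
    and enc: "valid_encoding \<Omega> std enc" "\<omega> \<in> \<Omega>"
    and \<epsilon>: "0 < \<epsilon>" "\<epsilon> \<le> 1 / 32" "\<theta> = 16 * \<epsilon>" and m: "1 / \<epsilon>\<^sup>2 \<le> real (2 * m)"
  shows "real (bits_sent \<Omega> std enc t \<omega>) \<ge> 1 / 32768 * ((1 / \<epsilon>\<^sup>2) / log 2 (1 / \<epsilon>))"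
proof -
  let ?l = "log 2 (1 / \<epsilon>)"
  have "log 2 (2 ^ 5) \<le> ?l" using \<epsilon> by (subst log_le_cancel_iff) (auto simp: field_simps)
  moreover have "log 2 ((2 :: real) ^ 5) = 5" by (subst log_nat_power) auto
  ultimately have l: "5 \<le> ?l" by simp
  have "log 2 (2 / ((1 - 1 / 2) * \<epsilon>)) = log 2 (2 ^ 2 * (1 / \<epsilon>))" by simp
  also have "\<dots> = log 2 (2 ^ 2) + ?l" using \<epsilon>(1) by (subst log_mult) auto
  also have "log 2 ((2 :: real) ^ 2) = 2" by (subst log_nat_power) auto
  finally have l': "log 2 (2 / ((1 - 1 / 2) * \<epsilon>)) = 2 + ?l" .
  have "1 / 32768 * ((1 / \<epsilon>\<^sup>2) / ?l) = 1 / 16384 * (1 / (\<epsilon>\<^sup>2 * (2 * ?l)))" by simp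
  also have "\<dots> \<le> 1 / 16384 * (1 / (\<epsilon>\<^sup>2 * (2 + ?l)))"
    using l \<epsilon>(1,2) by (intro mult_left_mono divide_left_mono mult_pos_pos) auto
  also have "\<dots> \<le> real t"
    using messages_std_lower_bound[OF agree \<epsilon> m] unfolding l' by simp
  finally have "1 / 32768 * ((1 / \<epsilon>\<^sup>2) / ?l) \<le> real t" .
  \<comment> \<open>Bits are counted only for the first \<open>2 * m\<close> messages, so the bound
    must also lie below \<open>2 * m\<close>.\<close>
  moreover have "1 / 32768 * ((1 / \<epsilon>\<^sup>2) / ?l) \<le> 1 / \<epsilon>\<^sup>2"
  proof -
    have "(1 / \<epsilon>\<^sup>2) / ?l \<le> (1 / \<epsilon>\<^sup>2) / 1"
    proof (rule frac_le)
      show "1 \<le> ?l" using l by linarith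
    qed auto
    moreover have "0 \<le> 1 / \<epsilon>\<^sup>2" by simp
    ultimately show ?thesis by linarith
  qed
  ultimately have "1 / 32768 * ((1 / \<epsilon>\<^sup>2) / ?l) \<le> real (min t (2 * m))"
    using m by (simp add: min_def)
  then show ?thesis using bits_sent_std[OF enc, of t] by linarith
qed

end

section \<open>Choice of the instance and the constants\<close>

theorem theorem7:
  "\<exists>c>0. \<exists>C>0. \<exists>\<epsilon>\<^sub>0>0. \<forall>\<epsilon>::real. \<epsilon> > 0 \<longrightarrow>
    (\<exists>(\<Omega> :: (bool list \<times> bool list) set) (D :: (bool list \<times> bool list) pmf)
        (f :: bool list \<times> bool list \<Rightarrow> real).
      finite \<Omega> \<and> set_pmf D = \<Omega> \<and> (\<forall>\<omega>\<in>\<Omega>. 0 \<le> f \<omega> \<and> f \<omega> \<le> 1) \<and>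
      (\<forall>\<delta>::real. \<delta> > 0 \<longrightarrow>
        (\<epsilon> \<le> \<epsilon>\<^sub>0 \<and> \<delta> < 1 \<longrightarrow>
          (\<forall>t. agree_after \<Omega> D f (standard_protocol D f) \<epsilon> \<delta> t \<longrightarrow>
            real t \<ge> c * (1 / (\<epsilon>\<^sup>2 * log 2 (2 / ((1 - \<delta>) * \<epsilon>)))))) \<and>
        (\<exists>(P :: (bool list, bool list, bool list) protocol) (b :: nat).
          agree_after \<Omega> D f P \<epsilon> \<delta> 2 \<and>
          (\<forall>\<omega>\<in>\<Omega>. \<forall>k<2. length (message \<Omega> P k \<omega>) = b) \<and>
          real b \<le> C * max 1 (log 2 (1 / \<delta>)) \<and>
          (\<delta> = 1/2 \<longrightarrow>
            (\<epsilon> \<le> \<epsilon>\<^sub>0 \<longrightarrow>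
              (\<forall>enc t. valid_encoding \<Omega> (standard_protocol D f) enc \<and>
                  agree_after \<Omega> D f (standard_protocol D f) \<epsilon> \<delta> t \<longrightarrow>
                (\<forall>\<omega>\<in>\<Omega>. real (bits_sent \<Omega> (standard_protocol D f) enc t \<omega>)
                  \<ge> c * ((1 / \<epsilon>\<^sup>2) / log 2 (1 / \<epsilon>))))) \<and>
            (\<forall>\<omega>\<in>\<Omega>. real (bits_sent \<Omega> P (\<lambda>_. id) 2 \<omega>) \<le> C)))))"
\<comment> \<open>\<open>1 / 32768\<close> is the smaller constant of the two lower bounds, 2 is the
  number of bits exchanged, and \<open>1 / 32\<close> keeps \<open>16 * \<epsilon>\<close> at most
  1/2.\<close>
proof (rule exI[of _ "1 / 32768"], intro conjI, simp,
    rule exI[of _ 2], intro conjI, simp, rule exI[of _ "1 / 32"], intro conjI, simp,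
    intro allI impI)
  fix \<epsilon> :: real assume \<epsilon>: "\<epsilon> > 0"
  \<comment> \<open>The instance must serve all \<open>\<delta>\<close>. As the logarithm in the
    bound is at least 1, the claimed number of messages never exceeds
    \<open>1 / \<epsilon>\<^sup>2\<close>, so that many tosses suffice.\<close>
  define m where "m = nat \<lceil>1 / \<epsilon>\<^sup>2\<rceil>"
  have m: "1 / \<epsilon>\<^sup>2 \<le> real (2 * m)"
  proof -
    have "1 / \<epsilon>\<^sup>2 \<le> real m" unfolding m_def by (rule real_nat_ceiling_ge)
    then show ?thesis by simp
  qed
  interpret coin_game "16 * \<epsilon>" m by unfold_locales (use \<epsilon> in simp)
  have messages: "real t \<ge> 1 / 32768 * (1 / (\<epsilon>\<^sup>2 * log 2 (2 / ((1 - \<delta>) * \<epsilon>))))"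
    if "\<epsilon> \<le> 1 / 32" "0 < \<delta>" "\<delta> < 1" "agree_after \<Omega> prior target std \<epsilon> \<delta> t" for \<delta> t
    using messages_std_lower_bound[OF that(4) \<epsilon> that(1) refl m that(2,3)] by simp
  have bits: "bits_sent \<Omega> exchange (\<lambda>_. id) 2 \<omega> = 2" if "\<omega> \<in> \<Omega>" for \<omega>
    using that by (simp add: bits_sent_def message_exchange numeral_2_eq_2)
  show "\<exists>(\<Omega> :: (bool list \<times> bool list) set) (D :: (bool list \<times> bool list) pmf)
        (f :: bool list \<times> bool list \<Rightarrow> real).
      finite \<Omega> \<and> set_pmf D = \<Omega> \<and> (\<forall>\<omega>\<in>\<Omega>. 0 \<le> f \<omega> \<and> f \<omega> \<le> 1) \<and>
      (\<forall>\<delta>::real. \<delta> > 0 \<longrightarrow>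
        (\<epsilon> \<le> 1 / 32 \<and> \<delta> < 1 \<longrightarrow>
          (\<forall>t. agree_after \<Omega> D f (standard_protocol D f) \<epsilon> \<delta> t \<longrightarrow>
            real t \<ge> 1 / 32768 * (1 / (\<epsilon>\<^sup>2 * log 2 (2 / ((1 - \<delta>) * \<epsilon>)))))) \<and>
        (\<exists>(P :: (bool list, bool list, bool list) protocol) (b :: nat).
          agree_after \<Omega> D f P \<epsilon> \<delta> 2 \<and>
          (\<forall>\<omega>\<in>\<Omega>. \<forall>k<2. length (message \<Omega> P k \<omega>) = b) \<and>
          real b \<le> 2 * max 1 (log 2 (1 / \<delta>)) \<and>
          (\<delta> = 1/2 \<longrightarrow>
            (\<epsilon> \<le> 1 / 32 \<longrightarrow>
              (\<forall>enc t. valid_encoding \<Omega> (standard_protocol D f) enc \<and>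
                  agree_after \<Omega> D f (standard_protocol D f) \<epsilon> \<delta> t \<longrightarrow>
                (\<forall>\<omega>\<in>\<Omega>. real (bits_sent \<Omega> (standard_protocol D f) enc t \<omega>)
                  \<ge> 1 / 32768 * ((1 / \<epsilon>\<^sup>2) / log 2 (1 / \<epsilon>))))) \<and>
            (\<forall>\<omega>\<in>\<Omega>. real (bits_sent \<Omega> P (\<lambda>_. id) 2 \<omega>) \<le> 2))))"
  proof (rule exI[of _ \<Omega>], rule exI[of _ prior], rule exI[of _ target], intro conjI allI impI)
    show "finite \<Omega>" by (rule finite_states)
    show "set_pmf prior = \<Omega>" by (rule set_pmf_prior)
    show "\<forall>\<omega>\<in>\<Omega>. 0 \<le> target \<omega> \<and> target \<omega> \<le> 1" by (simp add: target_def)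
  next
    fix \<delta> :: real and t
    assume "0 < \<delta>" "\<epsilon> \<le> 1 / 32 \<and> \<delta> < 1" "agree_after \<Omega> prior target std \<epsilon> \<delta> t"
    then show "real t \<ge> 1 / 32768 * (1 / (\<epsilon>\<^sup>2 * log 2 (2 / ((1 - \<delta>) * \<epsilon>))))"
      by (intro messages) auto
  next
    fix \<delta> :: real assume \<delta>: "0 < \<delta>"
    show "\<exists>(P :: (bool list, bool list, bool list) protocol) (b :: nat).
          agree_after \<Omega> prior target P \<epsilon> \<delta> 2 \<and>
          (\<forall>\<omega>\<in>\<Omega>. \<forall>k<2. length (message \<Omega> P k \<omega>) = b) \<and>
          real b \<le> 2 * max 1 (log 2 (1 / \<delta>)) \<and>
          (\<delta> = 1/2 \<longrightarrow>
            (\<epsilon> \<le> 1 / 32 \<longrightarrow>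
              (\<forall>enc t. valid_encoding \<Omega> std enc \<and> agree_after \<Omega> prior target std \<epsilon> \<delta> t \<longrightarrow>
                (\<forall>\<omega>\<in>\<Omega>. real (bits_sent \<Omega> std enc t \<omega>)
                  \<ge> 1 / 32768 * ((1 / \<epsilon>\<^sup>2) / log 2 (1 / \<epsilon>))))) \<and>
            (\<forall>\<omega>\<in>\<Omega>. real (bits_sent \<Omega> P (\<lambda>_. id) 2 \<omega>) \<le> 2))"
    proof (rule exI[of _ exchange], rule exI[of _ 1], intro conjI impI allI ballI)
      show "agree_after \<Omega> prior target exchange \<epsilon> \<delta> 2" by (rule agree_exchange[OF \<epsilon> \<delta>])
      show "length (message \<Omega> exchange k \<omega>) = 1" if "\<omega> \<in> \<Omega>" for \<omega> k
        using that by (simp add: message_exchange)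
      show "real 1 \<le> 2 * max 1 (log 2 (1 / \<delta>))" by simp
      show "real (bits_sent \<Omega> exchange (\<lambda>_. id) 2 \<omega>) \<le> 2" if "\<omega> \<in> \<Omega>" for \<omega>
        using bits[OF that] by simp
    next
      fix enc t \<omega>
      assume half: "\<delta> = 1 / 2" and small: "\<epsilon> \<le> 1 / 32" and \<omega>: "\<omega> \<in> \<Omega>"
        and *: "valid_encoding \<Omega> std enc \<and> agree_after \<Omega> prior target std \<epsilon> \<delta> t"
      have "agree_after \<Omega> prior target std \<epsilon> (1 / 2) t" using * unfolding half by blast
      then show "real (bits_sent \<Omega> std enc t \<omega>) \<ge> 1 / 32768 * ((1 / \<epsilon>\<^sup>2) / log 2 (1 / \<epsilon>))"
        using bits_std_lower_bound[OF _ conjunct1[OF *] \<omega> \<epsilon> small refl m] by blast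
    qed
  qed
qed

end
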